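(* Let $G$ be a finite simple cubic graph, let $H$ be the hexagon graph of $G$, and let $W$ be the set of white edges of $H$. For every blue perfect matching $M$ of $H$, the matching $M$ encodes an embedding of $G$ on a closed orientable surface whose set of face boundaries is the set of subgraphs of $G$ induced by the cycles in $M\Delta W$. Conversely, every embedding of $G$ on a closed orientable surface defines a blue perfect matching $M$ of $H$ such that the set of subgraphs of $G$ induced by the cycles in $M\Delta W$ coincides with the set of face boundaries of the embedding.
   Context: **Hexagon graph.** Let $G$ be a finite simple cubic graph with vertex set $V$ and edge set $E$. A hexagon graph $H$ of $G$ is built as follows. (1) Each $v\in V$ is replaced by a copy $h_v$ of $K_{3,3}$ (a "hexagon"), the $h_v$ being pairwise vertex disjoint, with $V(H)=\bigcup_{v\in V}V(h_v)$. (2) For each $v$, write $V(h_v)=\{v_i: i\in\mathbb{Z}_6\}$ and $E(h_v)=\{v_iv_{i+1},\,v_iv_{i+3}: i\in\mathbb{Z}_6\}$. To each neighbour $u$ of $v$ in $G$ assign an index $i_{v(u)}\in\{0,1,2\}\subset\mathbb{Z}_6$ so that the three neighbours of $v$ get pairwise distinct indices. (3) Let $X=\bigcup_{v\in V}\{v_0,v_2,v_4\}$ and $Y=\bigcup_{v\in V}\{v_1,v_3,v_5\}$. Each edge $uv\in E$ is replaced by two vertex disjoint edges $e_{uv},e'_{uv}$: if $v_{i_{v(u)}}$ and $u_{i_{u(v)}}$ both belong to $X$ or both belong to $Y$, then $e_{uv}=v_{i_{v(u)}}u_{i_{u(v)}+3}$ and $e'_{uv}=v_{i_{v(u)}+3}u_{i_{u(v)}}$;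 otherwise $e_{uv}=v_{i_{v(u)}}u_{i_{u(v)}}$ and $e'_{uv}=v_{i_{v(u)}+3}u_{i_{u(v)}+3}$. Finally $E(H)=\bigcup_{v\in V}E(h_v)\cup\{e_{uv},e'_{uv}:uv\in E\}$. All hexagon graphs of $G$ are isomorphic, so one speaks of the hexagon graph of $G$. **Colours.** Edges $v_iv_{i+3}$ are red, edges $v_iv_{i+1}$ are blue, and edges $e_{uv},e'_{uv}$ are white. The set $W$ of white edges is a perfect matching of $H$. A blue perfect matching is a perfect matching of $H$ containing only blue edges. For a blue perfect matching $M$, $M\Delta W=M\cup W$ is a disjoint union of cycles; each such cycle $C$ induces the subgraph of $G$ with edge set $\{uv\in E: e_{uv}\in C\text{ or }e'_{uv}\in C\}$. **Embeddings.** Embeddings of $G$ on closed orientable surfaces are represented combinatorially by rotation systems. A rotation system of $G$ is a collection $\pi=\{\pi_v: v\in V\}$ where $\pi_v$ is a cyclic permutation of the edges incident with $v$. The face boundaries of the embedding given by $\pi$ are the closed walks $e_1e_2\cdots e_k$ with $e_i=v^iv^{i+1}\in E$ (traversed from $v^i$ to $v^{i+1}$), $\pi_{v^{i+1}}(e_i)=e_{i+1}$, which close up with $e_{k+1}=e_1$ (traversed in the same direction), $k$ minimal; each is regarded as the subgraph of $G$ formed by its edges. Every rotation system gives an embedding on a closed orientable surface with these face boundaries, and every embedding on a closed orientable surface arises in this way. *)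

theory Defs
  imports Main "HOL-Library.Numeral_Type" "HOL-Combinatorics.Combinatorics"
begin

record 'v ugraph =
  verts :: "'v set"
  edges :: "'v set set"

definition simple_graph :: "'v ugraph \<Rightarrow> bool" where
  "simple_graph G \<longleftrightarrow> (\<forall>e\<in>edges G. e \<subseteq> verts G \<and> card e = 2)"

definition finite_graph :: "'v ugraph \<Rightarrow> bool" where
  "finite_graph G \<longleftrightarrow> finite (verts G) \<and> finite (edges G)"

definition incident_edges :: "'v ugraph \<Rightarrow> 'v \<Rightarrow> 'v set set" where
  "incident_edges G v = {e \<in> edges G. v \<in> e}"

definition cubic_graph :: "'v ugraph \<Rightarrow> bool" where
  "cubic_graph G \<longleftrightarrow> (\<forall>v\<in>verts G. card (incident_edges G v) = 3)"

definition neighbours :: "'v ugraph \<Rightarrow> 'v \<Rightarrow> 'v set" where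
  "neighbours G v = {u. {v, u} \<in> edges G}"

definition perfect_matching :: "'v ugraph \<Rightarrow> 'v set set \<Rightarrow> bool" where
  "perfect_matching G M \<longleftrightarrow> M \<subseteq> edges G \<and> (\<forall>v\<in>verts G. \<exists>!e. e \<in> M \<and> v \<in> e)"

text \<open>A cycle is identified with its edge set.\<close>

definition is_cycle :: "'v set set \<Rightarrow> bool" where
  "is_cycle C \<longleftrightarrow> (\<exists>k (x :: nat \<Rightarrow> 'v). 3 \<le> k \<and> inj_on x {..<k} \<and>
     C = (\<lambda>i. {x i, x (Suc i mod k)}) ` {..<k})"

definition subgraph_of_edges :: "'v set set \<Rightarrow> 'v ugraph" where
  "subgraph_of_edges F = \<lparr>verts = \<Union>F, edges = F\<rparr>"

section \<open>The hexagon graph\<close>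

text \<open>The vertex $v_i$ of the hexagon $h_v$ is the pair \<open>(v, i)\<close>, where the index \<open>i\<close> ranges
  over the type \<open>6\<close> of integers modulo 6. The index $i_{v(u)}$ is \<open>\<iota> v u\<close>.\<close>

definition index_assignment :: "'v ugraph \<Rightarrow> ('v \<Rightarrow> 'v \<Rightarrow> 6) \<Rightarrow> bool" where
  "index_assignment G \<iota> \<longleftrightarrow>
     (\<forall>v\<in>verts G. \<iota> v ` neighbours G v \<subseteq> {0, 1, 2} \<and> inj_on (\<iota> v) (neighbours G v))"

definition X_side :: "'v ugraph \<Rightarrow> ('v \<times> 6) set" where
  "X_side G = verts G \<times> {0, 2, 4}"

definition Y_side :: "'v ugraph \<Rightarrow> ('v \<times> 6) set" where
  "Y_side G = verts G \<times> {1, 3, 5}"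

definition same_side :: "'v ugraph \<Rightarrow> 'v \<times> 6 \<Rightarrow> 'v \<times> 6 \<Rightarrow> bool" where
  "same_side G p q \<longleftrightarrow> p \<in> X_side G \<and> q \<in> X_side G \<or> p \<in> Y_side G \<and> q \<in> Y_side G"

text \<open>The edges $e_{uv}$ and $e'_{uv}$. Exchanging \<open>u\<close> and \<open>v\<close> may exchange the two edges, but
  does not change the unordered pair that they form.\<close>

definition edge1 :: "'v ugraph \<Rightarrow> ('v \<Rightarrow> 'v \<Rightarrow> 6) \<Rightarrow> 'v \<Rightarrow> 'v \<Rightarrow> ('v \<times> 6) set" where
  "edge1 G \<iota> u v =
     (if same_side G (v, \<iota> v u) (u, \<iota> u v)
      then {(v, \<iota> v u), (u, \<iota> u v + 3)}
      else {(v, \<iota> v u), (u, \<iota> u v)})"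

definition edge2 :: "'v ugraph \<Rightarrow> ('v \<Rightarrow> 'v \<Rightarrow> 6) \<Rightarrow> 'v \<Rightarrow> 'v \<Rightarrow> ('v \<times> 6) set" where
  "edge2 G \<iota> u v =
     (if same_side G (v, \<iota> v u) (u, \<iota> u v)
      then {(v, \<iota> v u + 3), (u, \<iota> u v)}
      else {(v, \<iota> v u + 3), (u, \<iota> u v + 3)})"

definition blue_edges :: "'v ugraph \<Rightarrow> ('v \<times> 6) set set" where
  "blue_edges G = {{(v, i), (v, i + 1)} | v i. v \<in> verts G}"

definition red_edges :: "'v ugraph \<Rightarrow> ('v \<times> 6) set set" where
  "red_edges G = {{(v, i), (v, i + 3)} | v i. v \<in> verts G}"

definition white_edges :: "'v ugraph \<Rightarrow> ('v \<Rightarrow> 'v \<Rightarrow> 6) \<Rightarrow> ('v \<times> 6) set set" where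
  "white_edges G \<iota> = (\<Union>{{edge1 G \<iota> u v, edge2 G \<iota> u v} | u v. {u, v} \<in> edges G})"

definition hexagon_graph :: "'v ugraph \<Rightarrow> ('v \<Rightarrow> 'v \<Rightarrow> 6) \<Rightarrow> ('v \<times> 6) ugraph" where
  "hexagon_graph G \<iota> =
     \<lparr>verts = verts G \<times> UNIV, edges = blue_edges G \<union> red_edges G \<union> white_edges G \<iota>\<rparr>"

definition blue_perfect_matching ::
    "'v ugraph \<Rightarrow> ('v \<Rightarrow> 'v \<Rightarrow> 6) \<Rightarrow> ('v \<times> 6) set set \<Rightarrow> bool" where
  "blue_perfect_matching G \<iota> M \<longleftrightarrow> perfect_matching (hexagon_graph G \<iota>) M \<and> M \<subseteq> blue_edges G"

definition induced_subgraph ::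
    "'v ugraph \<Rightarrow> ('v \<Rightarrow> 'v \<Rightarrow> 6) \<Rightarrow> ('v \<times> 6) set set \<Rightarrow> 'v ugraph" where
  "induced_subgraph G \<iota> C = subgraph_of_edges
     {{u, v} | u v. {u, v} \<in> edges G \<and> (edge1 G \<iota> u v \<in> C \<or> edge2 G \<iota> u v \<in> C)}"

definition cycle_subgraphs ::
    "'v ugraph \<Rightarrow> ('v \<Rightarrow> 'v \<Rightarrow> 6) \<Rightarrow> ('v \<times> 6) set set \<Rightarrow> 'v ugraph set" where
  "cycle_subgraphs G \<iota> M = induced_subgraph G \<iota> `
     {C. is_cycle C \<and> C \<subseteq> sym_diff M (white_edges G \<iota>)}"

section \<open>Rotation systems and face boundaries\<close>

definition rotation_system :: "'v ugraph \<Rightarrow> ('v \<Rightarrow> 'v set \<Rightarrow> 'v set) \<Rightarrow> bool" where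
  "rotation_system G \<pi> \<longleftrightarrow>
     (\<forall>v\<in>verts G. \<pi> v permutes incident_edges G v \<and> cyclic_on (\<pi> v) (incident_edges G v))"

text \<open>The \<open>i\<close>-th edge of the closed walk (of length \<open>k\<close>) is \<open>{x i, x (Suc i)}\<close>, traversed from
  \<open>x i\<close> to \<open>x (Suc i)\<close>. The walk closes up when an edge is repeated in the same direction; mere
  repetition of a vertex, or of an edge in the opposite direction, is allowed before that.\<close>

definition face_walk ::
    "'v ugraph \<Rightarrow> ('v \<Rightarrow> 'v set \<Rightarrow> 'v set) \<Rightarrow> (nat \<Rightarrow> 'v) \<Rightarrow> nat \<Rightarrow> bool" where
  "face_walk G \<pi> x k \<longleftrightarrow> 0 < k \<and>
     (\<forall>i\<le>k. {x i, x (Suc i)} \<in> edges G) \<and>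
     (\<forall>i<k. \<pi> (x (Suc i)) {x i, x (Suc i)} = {x (Suc i), x (Suc (Suc i))}) \<and>
     (x k, x (Suc k)) = (x 0, x 1) \<and>
     (\<forall>j. 0 < j \<and> j < k \<longrightarrow> (x j, x (Suc j)) \<noteq> (x 0, x 1))"

definition face_boundaries :: "'v ugraph \<Rightarrow> ('v \<Rightarrow> 'v set \<Rightarrow> 'v set) \<Rightarrow> 'v ugraph set" where
  "face_boundaries G \<pi> =
     {subgraph_of_edges ((\<lambda>i. {x i, x (Suc i)}) ` {..<k}) | x k. face_walk G \<pi> x k}"

end

theory Submission imports Defs begin

text \<open>The white edges of \<open>H\<close> correspond to the arcs of \<open>G\<close>: every white edge joins sides
  \<open>X\<close> and \<open>Y\<close>, and the arc \<open>(u, v)\<close> is the white edge whose \<open>Y\<close>-end lies in \<open>h\<^sub>u\<close> and whose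
  \<open>X\<close>-end lies in \<open>h\<^sub>v\<close>. On each hexagon, a blue perfect matching is one of the two perfect
  matchings of a 6-cycle; it joins the \<open>X\<close>-end for the neighbour of index \<open>c\<close> to the \<open>Y\<close>-end for
  the neighbour of index \<open>c + 1\<close>, respectively \<open>c - 1\<close>, modulo 3. These are the two cyclic
  permutations of three edges, so blue perfect matchings correspond to rotation systems. Following
  a cycle of \<open>M \<union> W\<close> through white edges from \<open>Y\<close> to \<open>X\<close> then follows the permutation of the
  arcs that traces the faces.\<close>

section \<open>Orbits of a permutation of a finite set\<close>

lemma permutes_orbit_self:
  assumes "f permutes A" "finite A"
  shows "a \<in> orbit f a"
  by (rule permutation_self_in_orbit[OF permutes_imp_permutation[OF assms(2,1)]])

lemma permutes_orbit_step:
  assumes "f permutes A" "finite A"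
  shows "orbit f (f a) = orbit f a"
  by (rule permutation_orbit_step[OF permutes_imp_permutation[OF assms(2,1)]])

text \<open>The period is \<open>funpow_dist1 f a a\<close>, the least positive return time, which
  exists because \<open>a\<close> lies in its own orbit.\<close>

lemma permutes_least_period:
  assumes "f permutes A" "finite A"
  obtains k where "0 < k" "(f ^^ k) a = a" "inj_on (\<lambda>n. (f ^^ n) a) {..<k}"
    "\<And>j. 0 < j \<Longrightarrow> j < k \<Longrightarrow> (f ^^ j) a \<noteq> a"
    "orbit f a = (\<lambda>n. (f ^^ n) a) ` {..<k}"
proof (rule that)
  have a: "a \<in> orbit f a" using assms by (rule permutes_orbit_self)
  show "0 < funpow_dist1 f a a" by simp
  show "(f ^^ funpow_dist1 f a a) a = a" using a by (rule funpow_dist1_prop)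
  show "inj_on (\<lambda>n. (f ^^ n) a) {..<funpow_dist1 f a a}"
    using inj_on_funpow_dist1[OF a] by (simp add: atLeast0LessThan)
  show "(f ^^ j) a \<noteq> a" if "0 < j" "j < funpow_dist1 f a a" for j
    using that by (rule funpow_dist1_least)
  show "orbit f a = (\<lambda>n. (f ^^ n) a) ` {..<funpow_dist1 f a a}"
    using orbit_conv_funpow_dist1[OF a] by (simp add: atLeast0LessThan)
qed

section \<open>Cycles of a permutation as cycles of a graph\<close>

text \<open>With period 1 or 2, \<open>\<tau>\<close> applied twice would fix \<open>p\<close>;
  hence the orbit has the three or more elements that \<open>is_cycle\<close> demands.\<close>

lemma is_cycle_orbit:
  assumes perm: "\<tau> permutes P" "finite P" and no2: "\<tau> (\<tau> p) \<noteq> p"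
  shows "is_cycle ((\<lambda>q. {q, \<tau> q}) ` orbit \<tau> p)"
proof -
  obtain k where k: "0 < k" "(\<tau> ^^ k) p = p" "inj_on (\<lambda>n. (\<tau> ^^ n) p) {..<k}"
    "orbit \<tau> p = (\<lambda>n. (\<tau> ^^ n) p) ` {..<k}"
    using permutes_least_period[OF perm] by metis
  have "k \<noteq> 1" "k \<noteq> 2" using k(2) no2 by (auto simp: numeral_2_eq_2)
  then have "3 \<le> k" using k(1) by linarith
  have step: "\<tau> ((\<tau> ^^ i) p) = (\<tau> ^^ (Suc i mod k)) p" if "i < k" for i
    using that k(2) by (cases "Suc i = k") auto
  have "(\<lambda>q. {q, \<tau> q}) ` orbit \<tau> p = (\<lambda>i. {(\<tau> ^^ i) p, (\<tau> ^^ (Suc i mod k)) p}) ` {..<k}"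
    unfolding k(4) image_image using step by (intro image_cong) auto
  with \<open>3 \<le> k\<close> k(3) show ?thesis
    unfolding is_cycle_def by (intro exI[of _ k] exI[of _ "\<lambda>n. (\<tau> ^^ n) p"]) simp
qed

text \<open>Since \<open>\<tau>\<close> is injective, a cycle of the graph cannot change between following \<open>\<tau>\<close> and
  following its inverse.\<close>

lemma is_cycle_in_permutation_graph:
  assumes perm: "\<tau> permutes P" "finite P"
    and C: "is_cycle C" "C \<subseteq> (\<lambda>p. {p, \<tau> p}) ` P"
  obtains p where "p \<in> P" "C = (\<lambda>q. {q, \<tau> q}) ` orbit \<tau> p"
proof -
  obtain k x where kx: "3 \<le> k" "inj_on x {..<k}" "C = (\<lambda>i. {x i, x (Suc i mod k)}) ` {..<k}"
    using C(1) unfolding is_cycle_def by blast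
  \<comment> \<open>Unrolled periodically, the cycle has a successor at every index, so inductions
    need not treat the closing edge separately.\<close>
  define z where "z i = x (i mod k)" for i
  have per: "z (i + k * n) = z i" for i n
    by (simp add: z_def)
  \<comment> \<open>Vertices two steps apart could coincide only if \<open>k\<close> divided
    2.\<close>
  have ne: "z (Suc (Suc i)) \<noteq> z i" for i
  proof
    assume "z (Suc (Suc i)) = z i"
    then have "Suc (Suc i) mod k = i mod k"
      using kx(1,2) by (auto simp: z_def dest!: inj_onD)
    then have "k dvd 2"
      using mod_eq_dvd_iff_nat[of i "Suc (Suc i)" k] by (auto simp: numeral_2_eq_2)
    then show False using kx(1) by (auto dest: dvd_imp_le)
  qed
  have Cz: "C = range (\<lambda>i. {z i, z (Suc i)})"
  proof
    show "C \<subseteq> range (\<lambda>i. {z i, z (Suc i)})"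
      unfolding kx(3) by (auto simp: z_def intro!: rev_image_eqI)
    show "range (\<lambda>i. {z i, z (Suc i)}) \<subseteq> C"
    proof
      fix e assume "e \<in> range (\<lambda>i. {z i, z (Suc i)})"
      then obtain i where "e = {z i, z (Suc i)}" by blast
      then have "e = {x (i mod k), x (Suc (i mod k) mod k)}" by (simp add: z_def mod_Suc_eq)
      then show "e \<in> C" unfolding kx(3) using kx(1) by (intro image_eqI[of _ _ "i mod k"]) auto
    qed
  qed
  have inj: "\<tau> a = \<tau> b \<Longrightarrow> a = b" for a b
    using permutes_inj[OF perm(1)] by (rule injD)
  have edge: "\<exists>p\<in>P. {z i, z (Suc i)} = {p, \<tau> p}" for i
    using C(2) Cz by blast
  have zP: "z 0 \<in> P"
    using edge[of 0] permutes_in_image[OF perm(1)] by (metis doubleton_eq_iff)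
  have dir: "z (Suc i) = \<tau> (z i) \<or> z i = \<tau> (z (Suc i))" for i
    using edge[of i] by (metis doubleton_eq_iff)
  have orb: "orbit \<tau> (z 0) = {(\<tau> ^^ n) (z 0) | n. True}"
    using permutes_orbit_self[OF perm] by (rule orbit_altdef_self_in)
  have "orbit \<tau> (z 0) = range z \<and> C = (\<lambda>q. {q, \<tau> q}) ` range z"
  proof (cases "z (Suc 0) = \<tau> (z 0)")
    case True
    \<comment> \<open>If the next edge ran against \<open>\<tau>\<close>, then \<open>z i\<close>
      and \<open>z (Suc (Suc i))\<close> would have the same image \<open>z (Suc i)\<close>, against
      injectivity and \<open>ne\<close>.\<close>
    have fwd: "z (Suc i) = \<tau> (z i)" for i
    proof (induction i)
      case (Suc i)
      then show ?case using dir[of "Suc i"] ne[of i] inj[of "z i" "z (Suc (Suc i))"] by metis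
    qed (use True in simp)
    have "(\<tau> ^^ n) (z 0) = z n" for n
      by (induction n) (simp_all add: fwd)
    then show ?thesis unfolding orb Cz by (auto simp: fwd)
  next
    case False
    \<comment> \<open>A reversal would make \<open>z i\<close> and \<open>z (Suc (Suc i))\<close>
      both equal to \<open>\<tau> (z (Suc i))\<close>, against \<open>ne\<close>.\<close>
    have bwd: "z i = \<tau> (z (Suc i))" for i
    proof (induction i)
      case (Suc i)
      then show ?case using dir[of "Suc i"] ne[of i] by metis
    qed (use False dir in auto)
    have goback: "(\<tau> ^^ n) (z (i + n)) = z i" for i n
      by (induction n) (simp_all add: bwd[symmetric] funpow_swap1)
    have "z i \<in> orbit \<tau> (z 0)" for i
    proof -
      \<comment> \<open>The exponent is chosen so that the sum is a multiple of \<open>k\<close> and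
        \<open>goback\<close> starts at \<open>z 0\<close>.\<close>
      have "i + (k - 1) * i = k * i" using kx(1) by (cases k) auto
      then have "z i = (\<tau> ^^ ((k - 1) * i)) (z 0)"
        using goback[of "(k - 1) * i" i] per[of 0 i] by simp
      then show ?thesis unfolding orb by blast
    qed
    moreover have "(\<tau> ^^ n) (z 0) \<in> range z" for n
    proof -
      have "n * (k - 1) + n = k * n" using kx(1) by (cases k) auto
      then have "(\<tau> ^^ n) (z 0) = z (n * (k - 1))"
        using goback[of n "n * (k - 1)"] per[of 0 n] by simp
      then show ?thesis by blast
    qed
    \<comment> \<open>In this direction \<open>\<tau>\<close> traverses the edge
      \<open>{z i, z (Suc i)}\<close> starting from \<open>z (Suc i)\<close>.\<close>
    moreover have shift: "range z = range (\<lambda>i. z (Suc i))"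
    proof -
      have "z i \<in> range (\<lambda>i. z (Suc i))" for i
      proof (rule range_eqI)
        show "z i = z (Suc (i + (k - 1)))" using per[of i 1] kx(1) by simp
      qed
      then show ?thesis by blast
    qed
    moreover have "(\<lambda>q. {q, \<tau> q}) ` range z = C"
      unfolding shift Cz image_image by (simp add: bwd[symmetric] insert_commute)
    ultimately show ?thesis unfolding orb by blast
  qed
  with zP show ?thesis using that[of "z 0"] by simp
qed

section \<open>Cycles alternating between two matchings\<close>

text \<open>\<open>s a\<close> and \<open>t a\<close> are the ends of the edge labelled
  \<open>a\<close> in the first matching, and the second matching leads from \<open>t a\<close> to
  \<open>s (\<sigma> a)\<close>. Contracting the labelled edges leaves the orbit of
  \<open>\<sigma>\<close>.\<close>

definition alternating_cycle :: "('a \<Rightarrow> 'a) \<Rightarrow> ('a \<Rightarrow> 'b) \<Rightarrow> ('a \<Rightarrow> 'b) \<Rightarrow> 'a \<Rightarrow> 'b set set" where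
  "alternating_cycle \<sigma> s t a =
     (\<lambda>b. {s b, t b}) ` orbit \<sigma> a \<union> (\<lambda>b. {t b, s (\<sigma> b)}) ` orbit \<sigma> a"

text \<open>The union of the two matchings is the graph of one permutation \<open>\<tau>\<close>,
  which runs through \<open>s a\<close>, \<open>t a\<close>, \<open>s (\<sigma> a)\<close> and so
  on; its cycles are therefore its orbits.\<close>

lemma cycles_of_alternating_graph:
  assumes perm: "\<sigma> permutes A" "finite A" and nofix: "\<And>a. a \<in> A \<Longrightarrow> \<sigma> a \<noteq> a"
    and s: "inj_on s A" and t: "inj_on t A" and disj: "s ` A \<inter> t ` A = {}"
  shows "{C. is_cycle C \<and> C \<subseteq> (\<lambda>a. {s a, t a}) ` A \<union> (\<lambda>a. {t a, s (\<sigma> a)}) ` A}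
         = alternating_cycle \<sigma> s t ` A"
proof -
  define P where "P = s ` A \<union> t ` A"
  define \<tau> where "\<tau> p = (if p \<in> s ` A then t (inv_into A s p)
    else if p \<in> t ` A then s (\<sigma> (inv_into A t p)) else p)" for p
  have \<sigma>A: "\<sigma> a \<in> A \<longleftrightarrow> a \<in> A" for a
    using perm(1) by (rule permutes_in_image)
  have \<sigma>inj: "\<sigma> a = \<sigma> b \<longleftrightarrow> a = b" for a b
    using permutes_inj[OF perm(1)] by (simp add: inj_eq)
  have \<tau>s: "\<tau> (s a) = t a" if "a \<in> A" for a
    using that s by (simp add: \<tau>_def)
  have \<tau>t: "\<tau> (t a) = s (\<sigma> a)" if "a \<in> A" for a
    using that t disj by (auto simp: \<tau>_def)
  have fin: "finite P" using perm(2) by (simp add: P_def)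
  have "\<tau> ` P = P"
  proof -
    have "\<tau> ` P = t ` A \<union> s ` \<sigma> ` A"
      by (auto simp: P_def image_Un image_image \<tau>s \<tau>t)
    then show ?thesis using permutes_image[OF perm(1)] by (auto simp: P_def)
  qed
  then have "bij_betw \<tau> P P"
    using fin by (simp add: bij_betw_def finite_surj_inj)
  then have \<tau>: "\<tau> permutes P"
    by (rule bij_imp_permutes) (auto simp: P_def \<tau>_def)
  \<comment> \<open>Two steps of \<open>\<tau>\<close> take \<open>s a\<close> to
    \<open>s (\<sigma> a)\<close> and \<open>t a\<close> to \<open>t (\<sigma> a)\<close>, and
    \<open>\<sigma>\<close> fixes nothing in \<open>A\<close>.\<close>
  have no2: "\<tau> (\<tau> p) \<noteq> p" if "p \<in> P" for p
    using that s t nofix by (auto simp: P_def \<tau>s \<tau>t \<sigma>A inj_on_eq_iff)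
  have graph: "(\<lambda>a. {s a, t a}) ` A \<union> (\<lambda>a. {t a, s (\<sigma> a)}) ` A = (\<lambda>p. {p, \<tau> p}) ` P"
    by (simp add: P_def image_Un image_image \<tau>s \<tau>t cong: image_cong)
  have orb: "orbit \<tau> (s a) = s ` orbit \<sigma> a \<union> t ` orbit \<sigma> a" if a: "a \<in> A" for a
  proof
    have sub: "orbit \<sigma> a \<subseteq> A" using permutes_orbit_subset[OF perm(1) a] .
    have pow: "(\<sigma> ^^ n) a \<in> A" for n by (induction n) (simp_all add: a \<sigma>A)
    have mem: "(\<sigma> ^^ n) a \<in> orbit \<sigma> a" for n
      using permutes_orbit_self[OF perm] by (rule funpow_in_orbit)
    show "orbit \<tau> (s a) \<subseteq> s ` orbit \<sigma> a \<union> t ` orbit \<sigma> a"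
    proof
      fix q assume "q \<in> orbit \<tau> (s a)"
      then show "q \<in> s ` orbit \<sigma> a \<union> t ` orbit \<sigma> a"
      proof induction
        case base
        then show ?case using a permutes_orbit_self[OF perm] by (simp add: \<tau>s)
      next
        case (step q)
        then show ?case using sub by (auto simp: \<tau>s \<tau>t subset_iff intro: orbit.step)
      qed
    qed
    have "s ((\<sigma> ^^ n) a) \<in> orbit \<tau> (s a)" for n
    proof (induction n)
      case 0
      show ?case using permutes_orbit_self[OF \<tau> fin] by simp
    next
      case (Suc n)
      then have "\<tau> (\<tau> (s ((\<sigma> ^^ n) a))) \<in> orbit \<tau> (s a)" by (intro orbit.step)
      then show ?case by (simp add: \<tau>s \<tau>t pow)
    qed
    moreover from this have "t ((\<sigma> ^^ n) a) \<in> orbit \<tau> (s a)" for n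
      using orbit.step[of "s ((\<sigma> ^^ n) a)" \<tau> "s a"] by (simp add: \<tau>s pow)
    ultimately show "s ` orbit \<sigma> a \<union> t ` orbit \<sigma> a \<subseteq> orbit \<tau> (s a)"
      unfolding orbit_altdef_self_in[OF permutes_orbit_self[OF perm]] by auto
  qed
  have cyc: "(\<lambda>q. {q, \<tau> q}) ` orbit \<tau> (s a) = alternating_cycle \<sigma> s t a" if a: "a \<in> A" for a
    using permutes_orbit_subset[OF perm(1) a]
    by (simp add: orb[OF a] alternating_cycle_def image_Un image_image \<tau>s \<tau>t subset_iff
        cong: image_cong)
  \<comment> \<open>The orbit of \<open>t a\<close> is also that of \<open>s a\<close>, since
    \<open>\<tau> (s a) = t a\<close>.\<close>
  have orbs: "\<exists>a\<in>A. orbit \<tau> p = orbit \<tau> (s a)" if "p \<in> P" for p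
    using that permutes_orbit_step[OF \<tau> fin] \<tau>s unfolding P_def by (metis UnE imageE)
  show ?thesis
  proof (intro subset_antisym subsetI)
    fix C assume "C \<in> {C. is_cycle C \<and> C \<subseteq> (\<lambda>a. {s a, t a}) ` A \<union> (\<lambda>a. {t a, s (\<sigma> a)}) ` A}"
    then obtain p where p: "p \<in> P" "C = (\<lambda>q. {q, \<tau> q}) ` orbit \<tau> p"
      unfolding graph using is_cycle_in_permutation_graph[OF \<tau> fin] by blast
    obtain a where a: "a \<in> A" "orbit \<tau> p = orbit \<tau> (s a)" using orbs[OF p(1)] by blast
    then have "C = alternating_cycle \<sigma> s t a" using cyc p(2) by simp
    with a(1) show "C \<in> alternating_cycle \<sigma> s t ` A" by blast
  next
    fix C assume "C \<in> alternating_cycle \<sigma> s t ` A"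
    then obtain a where a: "a \<in> A" "C = (\<lambda>q. {q, \<tau> q}) ` orbit \<tau> (s a)" using cyc by auto
    have sa: "s a \<in> P" using a(1) by (simp add: P_def)
    have "orbit \<tau> (s a) \<subseteq> P" using permutes_orbit_subset[OF \<tau> sa] .
    then show "C \<in> {C. is_cycle C \<and> C \<subseteq> (\<lambda>a. {s a, t a}) ` A \<union> (\<lambda>a. {t a, s (\<sigma> a)}) ` A}"
      unfolding graph using is_cycle_orbit[OF \<tau> fin no2[OF sa]] a(2) by blast
  qed
qed

section \<open>Face boundaries as orbits of arcs\<close>

definition arcs :: "'v ugraph \<Rightarrow> ('v \<times> 'v) set" where
  "arcs G = {(u, v). {u, v} \<in> edges G}"

text \<open>The face-tracing map. \<open>THE\<close> extracts the far end of the edge that the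
  rotation at the head puts next; the value \<open>a\<close> off the arcs is what
  \<open>permutes\<close> requires.\<close>

definition next_arc :: "'v ugraph \<Rightarrow> ('v \<Rightarrow> 'v set \<Rightarrow> 'v set) \<Rightarrow> 'v \<times> 'v \<Rightarrow> 'v \<times> 'v" where
  "next_arc G \<pi> a =
     (if a \<in> arcs G then (snd a, THE w. \<pi> (snd a) {fst a, snd a} = {snd a, w}) else a)"

locale finite_simple_graph =
  fixes G :: "'v ugraph"
  assumes finite: "finite_graph G" and simple: "simple_graph G"
begin

lemma arcsD:
  assumes "(u, v) \<in> arcs G"
  shows "u \<in> verts G" "v \<in> verts G" "u \<noteq> v" "(v, u) \<in> arcs G"
proof -
  have "{u, v} \<subseteq> verts G" "card {u, v} = 2"
    using assms simple by (auto simp: arcs_def simple_graph_def)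
  then show "u \<in> verts G" "v \<in> verts G" "u \<noteq> v" by auto
  show "(v, u) \<in> arcs G" using assms by (simp add: arcs_def insert_commute)
qed

lemma finite_arcs: "finite (arcs G)"
proof (rule finite_subset)
  show "arcs G \<subseteq> verts G \<times> verts G" using arcsD by auto
  show "finite (verts G \<times> verts G)" using finite by (simp add: finite_graph_def)
qed

lemma incident_edges_eq: "incident_edges G v = (\<lambda>u. {v, u}) ` neighbours G v"
proof
  show "incident_edges G v \<subseteq> (\<lambda>u. {v, u}) ` neighbours G v"
  proof
    fix e assume "e \<in> incident_edges G v"
    then have e: "e \<in> edges G" "v \<in> e" "card e = 2"
      using simple by (auto simp: incident_edges_def simple_graph_def)
    then obtain u where "e = {v, u}" by (auto simp: card_2_iff)
    with e show "e \<in> (\<lambda>u. {v, u}) ` neighbours G v" by (simp add: neighbours_def)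
  qed
qed (auto simp: incident_edges_def neighbours_def)

text \<open>The rotation stays among the edges at \<open>v\<close>, so the image of
  \<open>{u, v}\<close> is \<open>{v, x}\<close> for exactly one \<open>x\<close>. This removes the
  definite description.\<close>

lemma next_arc_eq_iff:
  assumes \<pi>: "rotation_system G \<pi>" and uv: "(u, v) \<in> arcs G"
  shows "next_arc G \<pi> (u, v) = (v', w) \<longleftrightarrow> v' = v \<and> \<pi> v {u, v} = {v, w}"
proof -
  have "{u, v} \<in> incident_edges G v" "v \<in> verts G"
    using uv arcsD[OF uv] by (auto simp: incident_edges_def arcs_def)
  then have "\<pi> v {u, v} \<in> incident_edges G v"
    using \<pi> by (simp add: rotation_system_def permutes_in_image)
  then obtain x where x: "\<pi> v {u, v} = {v, x}"
    by (auto simp: incident_edges_eq)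
  then have "next_arc G \<pi> (u, v) = (v, x)"
    using uv by (auto simp: next_arc_def doubleton_eq_iff intro!: the_equality)
  with x show ?thesis by (auto simp: doubleton_eq_iff)
qed

lemma fst_next_arc: "a \<in> arcs G \<Longrightarrow> fst (next_arc G \<pi> a) = snd a"
  by (simp add: next_arc_def)

lemma next_arc_neq: "a \<in> arcs G \<Longrightarrow> next_arc G \<pi> a \<noteq> a"
  using arcsD(3) fst_next_arc by (metis prod.collapse)

text \<open>The image of an arc starts at the head of that arc. Arcs with equal images thus share
  their head \<open>v\<close>, and injectivity of \<open>\<pi> v\<close> identifies them; finiteness
  gives surjectivity.\<close>

lemma next_arc_permutes:
  assumes \<pi>: "rotation_system G \<pi>"
  shows "next_arc G \<pi> permutes arcs G"
proof -
  have \<pi>v: "\<pi> v permutes incident_edges G v" if "v \<in> verts G" for v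
    using \<pi> that by (simp add: rotation_system_def)
  have "next_arc G \<pi> ` arcs G \<subseteq> arcs G"
  proof
    fix b assume "b \<in> next_arc G \<pi> ` arcs G"
    then obtain u v where uv: "(u, v) \<in> arcs G" "b = next_arc G \<pi> (u, v)" by auto
    obtain w where b: "b = (v, w)" "\<pi> v {u, v} = {v, w}"
      using next_arc_eq_iff[OF \<pi> uv(1)] uv(2) by (metis prod.collapse)
    have "{u, v} \<in> incident_edges G v"
      using uv(1) by (simp add: incident_edges_def arcs_def)
    then have "{v, w} \<in> incident_edges G v"
      using b(2) permutes_in_image[OF \<pi>v[OF arcsD(2)[OF uv(1)]]] by metis
    then show "b \<in> arcs G" using b(1) by (simp add: incident_edges_def arcs_def)
  qed
  moreover have "inj_on (next_arc G \<pi>) (arcs G)"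
  proof (rule inj_onI)
    fix a b assume ab: "a \<in> arcs G" "b \<in> arcs G" "next_arc G \<pi> a = next_arc G \<pi> b"
    then have "snd a = snd b" using fst_next_arc by metis
    then obtain u u' v where a: "a = (u, v)" and b: "b = (u', v)" by (cases a; cases b) auto
    obtain w where "next_arc G \<pi> a = (v, w)"
      using fst_next_arc[OF ab(1)] a by (metis prod.collapse snd_conv)
    then have "\<pi> v {u, v} = \<pi> v {u', v}"
      using next_arc_eq_iff[OF \<pi>] ab a b by metis
    then have "{u, v} = {u', v}"
      using permutes_inj[OF \<pi>v] arcsD(2) ab(1) a by (metis injD)
    then show "a = b" using a b by (auto simp: doubleton_eq_iff)
  qed
  ultimately have "bij_betw (next_arc G \<pi>) (arcs G) (arcs G)"
    by (simp add: bij_betw_def endo_inj_surj finite_arcs)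
  then show ?thesis by (rule bij_imp_permutes) (simp add: next_arc_def)
qed

text \<open>A face walk closes up when its first arc, not merely its first edge, recurs, so its
  length is the period of that arc under \<open>next_arc\<close>.\<close>

lemma face_boundaries_eq:
  assumes \<pi>: "rotation_system G \<pi>"
  shows "face_boundaries G \<pi> =
    (\<lambda>a. subgraph_of_edges ((\<lambda>(u, v). {u, v}) ` orbit (next_arc G \<pi>) a)) ` arcs G"
    (is "_ = ?R")
proof
  let ?\<sigma> = "next_arc G \<pi>"
  note perm = next_arc_permutes[OF \<pi>] finite_arcs
  show "face_boundaries G \<pi> \<subseteq> ?R"
  proof
    fix F assume "F \<in> face_boundaries G \<pi>"
    then obtain x k where F: "F = subgraph_of_edges ((\<lambda>i. {x i, x (Suc i)}) ` {..<k})"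
      and walk: "face_walk G \<pi> x k"
      unfolding face_boundaries_def by blast
    let ?a = "(x 0, x 1)"
    have a: "?a \<in> arcs G" using walk by (auto simp: face_walk_def arcs_def)
    have pow: "(?\<sigma> ^^ i) ?a = (x i, x (Suc i))" if "i \<le> k" for i
      using that
    proof (induction i)
      case (Suc i)
      then have "(x i, x (Suc i)) \<in> arcs G"
        using walk by (simp add: face_walk_def arcs_def)
      then have "?\<sigma> (x i, x (Suc i)) = (x (Suc i), x (Suc (Suc i)))"
        using walk Suc.prems by (simp add: next_arc_eq_iff[OF \<pi>] face_walk_def)
      then show ?case using Suc by simp
    qed simp
    have "(?\<sigma> ^^ k) ?a = ?a" "0 < k"
      using pow[of k] walk by (simp_all add: face_walk_def)
    then have "orbit ?\<sigma> ?a = {(?\<sigma> ^^ i) ?a | i. i < k}"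
      by (rule orbit_altdef_bounded)
    also have "\<dots> = (\<lambda>i. (?\<sigma> ^^ i) ?a) ` {..<k}" by auto
    also have "\<dots> = (\<lambda>i. (x i, x (Suc i))) ` {..<k}"
      by (rule image_cong) (simp_all add: pow del: One_nat_def)
    finally have "F = subgraph_of_edges ((\<lambda>(u, v). {u, v}) ` orbit ?\<sigma> ?a)"
      by (simp add: F image_image)
    then show "F \<in> ?R" using a by blast
  qed
  show "?R \<subseteq> face_boundaries G \<pi>"
  proof
    fix F assume "F \<in> ?R"
    then obtain a where a: "a \<in> arcs G"
      and F: "F = subgraph_of_edges ((\<lambda>(u, v). {u, v}) ` orbit ?\<sigma> a)" by blast
    obtain k where k: "0 < k" "(?\<sigma> ^^ k) a = a"
      "\<And>j. 0 < j \<Longrightarrow> j < k \<Longrightarrow> (?\<sigma> ^^ j) a \<noteq> a"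
      "orbit ?\<sigma> a = (\<lambda>n. (?\<sigma> ^^ n) a) ` {..<k}"
      using permutes_least_period[OF perm] by metis
    \<comment> \<open>Tails suffice, because the head of each arc is the tail of the next
      one.\<close>
    define x where "x i = fst ((?\<sigma> ^^ i) a)" for i
    have arc: "(?\<sigma> ^^ i) a \<in> arcs G" for i
      by (induction i) (simp_all add: a permutes_in_image[OF perm(1)])
    have pow: "(?\<sigma> ^^ i) a = (x i, x (Suc i))" for i
      by (simp add: x_def prod_eq_iff fst_next_arc[OF arc])
    have x01: "a = (x 0, x 1)" using pow[of 0] by simp
    have "face_walk G \<pi> x k"
      unfolding face_walk_def
    proof (intro conjI allI impI)
      show "{x i, x (Suc i)} \<in> edges G" for i
        using arc[of i] unfolding pow by (simp add: arcs_def)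
      show "\<pi> (x (Suc i)) {x i, x (Suc i)} = {x (Suc i), x (Suc (Suc i))}" for i
      proof -
        have "?\<sigma> (x i, x (Suc i)) = (x (Suc i), x (Suc (Suc i)))"
          using pow[of i] pow[of "Suc i"] by simp
        then show ?thesis using next_arc_eq_iff[OF \<pi> arc[of i, unfolded pow]] by simp
      qed
      show "(x k, x (Suc k)) = (x 0, x 1)" using k(2) unfolding pow x01[symmetric] .
      show "(x j, x (Suc j)) \<noteq> (x 0, x 1)" if "0 < j \<and> j < k" for j
        using k(3)[of j] that unfolding pow x01[symmetric] by simp
    qed (rule k(1))
    moreover have "(\<lambda>(u, v). {u, v}) ` orbit ?\<sigma> a = (\<lambda>i. {x i, x (Suc i)}) ` {..<k}"
      unfolding k(4) image_image pow by simp
    ultimately show "F \<in> face_boundaries G \<pi>"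
      unfolding face_boundaries_def F by auto
  qed
qed

end

section \<open>Blue perfect matchings and rotation systems\<close>

lemma UNIV_6: "(UNIV :: 6 set) = {0, 1, 2, 3, 4, 5}"
proof (rule sym, rule card_subset_eq)
  show "card {0, 1, 2, 3, 4, 5 :: 6} = card (UNIV :: 6 set)" by simp
qed simp_all

lemma cases_6: "(i :: 6) = 0 \<or> i = 1 \<or> i = 2 \<or> i = 3 \<or> i = 4 \<or> i = 5"
  using UNIV_6 by blast

text \<open>Of the two vertices of \<open>h\<^sub>v\<close> with indices \<open>c\<close> and \<open>c + 3\<close>, exactly one lies on side \<open>X\<close>.\<close>

definition X_index :: "6 \<Rightarrow> 6" where
  "X_index c = (if c = 1 then 4 else c)"

text \<open>Indices are added modulo 6, whereas \<open>turn\<close> is a shift modulo 3 on \<open>{0, 1, 2}\<close>; the value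
  \<open>5\<close> of \<open>blue_step\<close> is \<open>-1\<close>.\<close>

definition turn :: "bool \<Rightarrow> 6 \<Rightarrow> 6" where
  "turn d c = (if d then (if c = 2 then 0 else c + 1) else (if c = 0 then 2 else c - 1))"

definition blue_step :: "bool \<Rightarrow> 6" where
  "blue_step d = (if d then 1 else 5)"

text \<open>The link between matchings and rotations: one blue step from the \<open>X\<close>-vertex
  for index \<open>c\<close> reaches the \<open>Y\<close>-vertex for index
  \<open>turn d c\<close>.\<close>

lemma X_index_turn:
  "c \<in> {0, 1, 2} \<Longrightarrow> X_index (turn d c) + 3 = X_index c + blue_step d"
  by (auto simp: X_index_def turn_def blue_step_def)

lemma X_index_eq_iff: "c \<in> {0, 1, 2} \<Longrightarrow> c' \<in> {0, 1, 2} \<Longrightarrow> X_index c = X_index c' \<longleftrightarrow> c = c'"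
  by (auto simp: X_index_def)

text \<open>\<open>X_index\<close> takes even values here and adding 3 changes the parity, which
  makes sense modulo 6.\<close>

lemma X_index_neq_opposite: "c \<in> {0, 1, 2} \<Longrightarrow> c' \<in> {0, 1, 2} \<Longrightarrow> X_index c \<noteq> X_index c' + 3"
  by (auto simp: X_index_def)

lemma X_index_image: "X_index ` {0, 1, 2} = {0, 2, 4}"
  by (auto simp: X_index_def)

section \<open>Cyclic permutations of three elements\<close>

lemma three_cycle:
  assumes "a \<noteq> b" "b \<noteq> c" "a \<noteq> c"
  shows "id(a := b, b := c, c := a) permutes {a, b, c}"
    and "cyclic_on (id(a := b, b := c, c := a)) {a, b, c}"
proof -
  let ?f = "id(a := b, b := c, c := a)"
  have "bij_betw ?f {a, b, c} {a, b, c}"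
    using assms by (auto simp: bij_betw_def inj_on_def)
  then show "?f permutes {a, b, c}"
    by (rule bij_imp_permutes) auto
  have "orbit ?f a = {(?f ^^ n) a | n. n < 3}"
    using assms by (intro orbit_altdef_bounded) (simp_all add: numeral_3_eq_3)
  also have "\<dots> = (\<lambda>n. (?f ^^ n) a) ` {..<3}" by auto
  also have "\<dots> = {a, b, c}"
    using assms by (auto simp: numeral_3_eq_3 lessThan_Suc)
  finally show "cyclic_on ?f {a, b, c}" by (auto simp: cyclic_on_def)
qed

text \<open>A cycle through three elements has no fixed point, and injectivity then leaves only the
  two rotations.\<close>

lemma cyclic_permutation_3:
  assumes p: "p permutes {a, b, c}" "cyclic_on p {a, b, c}" and "a \<noteq> b" "b \<noteq> c" "a \<noteq> c"
  shows "p a = b \<and> p b = c \<and> p c = a \<or> p a = c \<and> p c = b \<and> p b = a"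
proof -
  have nofix: "p x \<noteq> x" if "x \<in> {a, b, c}" for x
    using eq_on_cyclic_on_iff1[OF p(2) that] assms(3-5) by auto
  have "p a \<in> {a, b, c}" "p b \<in> {a, b, c}" "p c \<in> {a, b, c}"
    using permutes_in_image[OF p(1)] by auto
  moreover have "p a \<noteq> p b" "p b \<noteq> p c" "p a \<noteq> p c"
    using permutes_inj[OF p(1)] assms(3-5) by (auto dest: injD)
  ultimately show ?thesis using nofix[of a] nofix[of b] nofix[of c] by auto
qed

section \<open>Indices, ports and white edges\<close>

locale hexagon = finite_simple_graph G for G :: "'v ugraph" +
  fixes \<iota> :: "'v \<Rightarrow> 'v \<Rightarrow> 6"
  assumes cubic: "cubic_graph G" and index: "index_assignment G \<iota>"
begin

lemma arcs_iff: "(u, v) \<in> arcs G \<longleftrightarrow> u \<in> neighbours G v"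
  by (simp add: arcs_def neighbours_def insert_commute)

text \<open>The assignment is injective into \<open>{0, 1, 2}\<close>, and a vertex of a cubic graph
  has enough neighbours to use all three values.\<close>

lemma index_bij:
  assumes v: "v \<in> verts G"
  shows "bij_betw (\<iota> v) (neighbours G v) {0, 1, 2}"
proof -
  have inj: "inj_on (\<iota> v) (neighbours G v)" and sub: "\<iota> v ` neighbours G v \<subseteq> {0, 1, 2}"
    using index v by (auto simp: index_assignment_def)
  have "card (neighbours G v) = card (incident_edges G v)"
    unfolding incident_edges_eq by (intro card_image[symmetric]) (auto simp: inj_on_def doubleton_eq_iff)
  also have "\<dots> = 3" using cubic v by (simp add: cubic_graph_def)
  finally have "\<iota> v ` neighbours G v = {0, 1, 2}"
    using sub inj by (intro card_subset_eq) (simp_all add: card_image)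
  with inj show ?thesis by (simp add: bij_betw_def)
qed

lemma index_range: "(u, v) \<in> arcs G \<Longrightarrow> \<iota> v u \<in> {0, 1, 2}"
  using index_bij arcsD(2) arcs_iff by (metis bij_betwE)

lemma index_eq_iff: "(u, v) \<in> arcs G \<Longrightarrow> (w, v) \<in> arcs G \<Longrightarrow> \<iota> v u = \<iota> v w \<longleftrightarrow> u = w"
  using index_bij[OF arcsD(2)] unfolding arcs_iff bij_betw_def by (metis inj_on_eq_iff)

lemma neighbours_by_index:
  assumes "v \<in> verts G"
  obtains a b c where "neighbours G v = {a, b, c}" "\<iota> v a = 0" "\<iota> v b = 1" "\<iota> v c = 2"
    "a \<noteq> b" "b \<noteq> c" "a \<noteq> c"
proof -
  note bij = index_bij[OF assms]
  let ?nb = "inv_into (neighbours G v) (\<iota> v)"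
  have "?nb ` {0, 1, 2} = neighbours G v"
    using bij_betw_inv_into[OF bij] by (simp add: bij_betw_def)
  then have "neighbours G v = {?nb 0, ?nb 1, ?nb 2}" by simp
  moreover have nb: "\<iota> v (?nb 0) = 0" "\<iota> v (?nb 1) = 1" "\<iota> v (?nb 2) = 2"
    using bij by (auto intro: bij_betw_inv_into_right)
  moreover have "(0 :: 6) \<noteq> 1" "(1 :: 6) \<noteq> 2" "(0 :: 6) \<noteq> 2" by simp_all
  then have "?nb 0 \<noteq> ?nb 1" "?nb 1 \<noteq> ?nb 2" "?nb 0 \<noteq> ?nb 2" using nb by metis+
  ultimately show ?thesis by (rule that)
qed

text \<open>The ends of the white edge that represents an arc: \<open>in_port\<close> is the end on
  side \<open>X\<close>, in the hexagon of the head; \<open>out_port\<close>, with its shift by 3,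
  is the end on side \<open>Y\<close>, in the hexagon of the tail.\<close>

definition in_port :: "'v \<times> 'v \<Rightarrow> 'v \<times> 6" where
  "in_port a = (snd a, X_index (\<iota> (snd a) (fst a)))"

definition out_port :: "'v \<times> 'v \<Rightarrow> 'v \<times> 6" where
  "out_port a = (fst a, X_index (\<iota> (fst a) (snd a)) + 3)"

definition white_edge :: "'v \<times> 'v \<Rightarrow> ('v \<times> 6) set" where
  "white_edge a = {out_port a, in_port a}"

text \<open>All combinations of indices are checked. Only the unordered pairs agree, because the
  index \<open>\<iota> v u\<close> decides which of the two edges represents the arc
  \<open>(u, v)\<close>.\<close>

lemma edge12_eq:
  assumes "(u, v) \<in> arcs G"
  shows "{edge1 G \<iota> u v, edge2 G \<iota> u v} = {white_edge (u, v), white_edge (v, u)}"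
proof -
  have "u \<in> verts G" "v \<in> verts G" using arcsD[OF assms] by auto
  moreover have "\<iota> v u \<in> {0, 1, 2}" "\<iota> u v \<in> {0, 1, 2}"
    using index_range[OF assms] index_range[OF arcsD(4)[OF assms]] by auto
  ultimately show ?thesis
    by (elim insertE emptyE)
      (simp_all add: edge1_def edge2_def white_edge_def in_port_def out_port_def same_side_def
        X_side_def Y_side_def X_index_def doubleton_eq_iff)
qed

lemma white_edges_eq: "white_edges G \<iota> = white_edge ` arcs G"
proof -
  have "white_edges G \<iota> = (\<Union>(u, v)\<in>arcs G. {edge1 G \<iota> u v, edge2 G \<iota> u v})"
    by (auto simp: white_edges_def arcs_def)
  also have "\<dots> = (\<Union>(u, v)\<in>arcs G. {white_edge (u, v), white_edge (v, u)})"
    by (intro SUP_cong refl) (simp only: split_beta edge12_eq prod.collapse)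
  also have "\<dots> = white_edge ` arcs G"
    using arcsD(4) by (auto simp del: insert_iff)
  finally show ?thesis .
qed

lemma inj_in_port: "inj_on in_port (arcs G)"
proof (rule inj_onI)
  fix a b assume ab: "a \<in> arcs G" "b \<in> arcs G" "in_port a = in_port b"
  obtain u v where a: "a = (u, v)" by (cases a)
  with ab obtain u' where b: "b = (u', v)" by (cases b) (simp add: in_port_def)
  have "X_index (\<iota> v u) = X_index (\<iota> v u')" using ab(3) a b by (simp add: in_port_def)
  then have "\<iota> v u = \<iota> v u'"
    by (rule X_index_eq_iff[THEN iffD1, OF index_range[OF ab(1)[unfolded a]] index_range[OF ab(2)[unfolded b]]])
  then show "a = b" using index_eq_iff ab(1,2) unfolding a b by blast
qed

text \<open>Up to the shift by 3, the \<open>out_port\<close> of an arc is the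
  \<open>in_port\<close> of the reversed arc.\<close>

lemma inj_out_port: "inj_on out_port (arcs G)"
proof (rule inj_onI)
  fix a b assume ab: "a \<in> arcs G" "b \<in> arcs G" "out_port a = out_port b"
  then have "in_port (prod.swap a) = in_port (prod.swap b)"
    by (auto simp: in_port_def out_port_def)
  moreover have "prod.swap a \<in> arcs G" "prod.swap b \<in> arcs G"
    using ab(1,2) arcsD(4) by (cases a; cases b; simp)+
  ultimately have "prod.swap a = prod.swap b"
    using inj_in_port by (simp add: inj_on_eq_iff)
  then show "a = b" by (metis swap_swap)
qed

lemma ports_disjoint: "out_port ` arcs G \<inter> in_port ` arcs G = {}"
proof -
  have "out_port (u, v) \<noteq> in_port (u', v')" if "(u, v) \<in> arcs G" "(u', v') \<in> arcs G" for u v u' v'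
    using X_index_neq_opposite[OF index_range index_range, OF that(2) arcsD(4)[OF that(1)]]
    by (auto simp: in_port_def out_port_def)
  then show ?thesis by force
qed

section \<open>Blue perfect matchings as a choice of direction at each vertex\<close>

text \<open>The blue perfect matching whose restriction to \<open>h\<^sub>v\<close> is selected by \<open>\<delta> v\<close>.\<close>

definition matching :: "('v \<Rightarrow> bool) \<Rightarrow> ('v \<times> 6) set set" where
  "matching \<delta> = {{(v, i), (v, i + blue_step (\<delta> v))} | v i. v \<in> verts G \<and> i \<in> {0, 2, 4}}"

text \<open>\<open>\<delta> v\<close> tells whether the rotation at \<open>v\<close> runs through
  the neighbours by cyclically increasing or decreasing index.\<close>

definition turns :: "('v \<Rightarrow> bool) \<Rightarrow> ('v \<Rightarrow> 'v set \<Rightarrow> 'v set) \<Rightarrow> bool" where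
  "turns \<delta> \<pi> \<longleftrightarrow> (\<forall>u v w. (u, v) \<in> arcs G \<longrightarrow> (w, v) \<in> arcs G \<longrightarrow>
     \<pi> v {u, v} = {v, w} \<longrightarrow> \<iota> v w = turn (\<delta> v) (\<iota> v u))"

text \<open>The blue edges of a hexagon form a 6-cycle, and each vertex lies on two consecutive
  ones. Membership in \<open>M\<close> therefore alternates, and the edge from index 0 to index 1
  decides everything.\<close>

lemma blue_perfect_matching_iff:
  "blue_perfect_matching G \<iota> M \<longleftrightarrow> (\<exists>\<delta>. M = matching \<delta>)"
proof
  assume "blue_perfect_matching G \<iota> M"
  then have blue: "M \<subseteq> blue_edges G"
    and ex1: "\<And>v i. v \<in> verts G \<Longrightarrow> \<exists>!e. e \<in> M \<and> (v, i) \<in> e"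
    by (auto simp: blue_perfect_matching_def perfect_matching_def hexagon_graph_def)
  let ?b = "\<lambda>v i. {(v, i), (v, i + 1)} \<in> M"
  have alt: "?b v (i + 1) \<longleftrightarrow> \<not> ?b v i" if v: "v \<in> verts G" for v and i :: 6
  proof
    assume "?b v (i + 1)"
    moreover have "{(v, i), (v, i + 1)} \<noteq> {(v, i + 1), (v, i + 1 + 1)}"
      using cases_6[of i] by (auto simp: doubleton_eq_iff)
    ultimately show "\<not> ?b v i" using ex1[OF v, of "i + 1"] by blast
  next
    assume not: "\<not> ?b v i"
    obtain e where e: "e \<in> M" "(v, i + 1) \<in> e" using ex1[OF v, of "i + 1"] by blast
    then obtain j where "e = {(v, j), (v, j + 1)}" using blue by (force simp: blue_edges_def)
    then show "?b v (i + 1)" using e not by auto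
  qed
  define \<delta> where "\<delta> v = ?b v 0" for v
  have b: "?b v 0 = \<delta> v" "?b v 1 = (\<not> \<delta> v)" "?b v 2 = \<delta> v" "?b v 3 = (\<not> \<delta> v)" "?b v 4 = \<delta> v"
    "?b v 5 = (\<not> \<delta> v)" if "v \<in> verts G" for v
    using alt[OF that, of 0] alt[OF that, of 1] alt[OF that, of 2] alt[OF that, of 3]
      alt[OF that, of 4] by (auto simp: \<delta>_def)
  have "M = matching \<delta>"
  proof
    show "M \<subseteq> matching \<delta>"
    proof
      fix e assume e: "e \<in> M"
      then obtain v i where v: "v \<in> verts G" "e = {(v, i), (v, i + 1)}"
        using blue by (auto simp: blue_edges_def)
      show "e \<in> matching \<delta>"
      proof (cases "i \<in> {0, 2, 4}")
        case True
        then have "\<delta> v" using b[OF v(1)] v e by auto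
        with True v show ?thesis by (auto simp: matching_def blue_step_def)
      next
        case False
        \<comment> \<open>An edge that starts at an odd index is read from its other end, on side
          \<open>X\<close>; adding 5 leads back to \<open>i\<close>.\<close>
        then have i: "i + 1 \<in> {0, 2, 4}" "i + 1 + 5 = i" "\<not> \<delta> v"
          using b[OF v(1)] v e cases_6[of i] by auto
        then have "e = {(v, i + 1), (v, i + 1 + blue_step (\<delta> v))}"
          unfolding v(2) blue_step_def by (simp only: if_False insert_commute)
        with i(1) v(1) show ?thesis unfolding matching_def by blast
      qed
    qed
    show "matching \<delta> \<subseteq> M"
    proof
      fix e assume "e \<in> matching \<delta>"
      then obtain v i where v: "v \<in> verts G" "i \<in> {0, 2, 4}" "e = {(v, i), (v, i + blue_step (\<delta> v))}"
        by (auto simp: matching_def)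
      \<comment> \<open>Sums of indices leave these numerals, which have to be reduced modulo
        6.\<close>
      have mod6: "(6 :: 6) = 0" "(7 :: 6) = 1" "(9 :: 6) = 3" by simp_all
      show "e \<in> M"
        using v b[OF v(1)] by (auto simp: mod6 blue_step_def insert_commute split: if_splits)
    qed
  qed
  then show "\<exists>\<delta>. M = matching \<delta>" by blast
next
  assume "\<exists>\<delta>. M = matching \<delta>"
  then obtain \<delta> where M: "M = matching \<delta>" ..
  have blue: "M \<subseteq> blue_edges G"
  proof
    fix e assume "e \<in> M"
    then obtain v i where v: "v \<in> verts G" "i \<in> {0, 2, 4}" "e = {(v, i), (v, i + blue_step (\<delta> v))}"
      by (auto simp: M matching_def)
    show "e \<in> blue_edges G"
    proof (cases "\<delta> v")
      case True
      with v show ?thesis by (auto simp: blue_edges_def blue_step_def)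
    next
      case False
      with v have "e = {(v, i + 5), (v, i + 5 + 1)}" by (auto simp: blue_step_def insert_commute)
      with v(1) show ?thesis unfolding blue_edges_def by blast
    qed
  qed
  have "\<exists>!e. e \<in> M \<and> (v, i) \<in> e" if v: "v \<in> verts G" for v i
  proof -
    \<comment> \<open>\<open>j\<close> is the index of the \<open>X\<close>-end of the matching edge
      through \<open>(v, i)\<close>.\<close>
    define j where "j = (if i \<in> {0, 2, 4} then i else i - blue_step (\<delta> v))"
    have key: "i = l \<or> i = l + blue_step (\<delta> v) \<longleftrightarrow> l = j" if "l \<in> {0, 2, 4}" for l
      using that cases_6[of i] by (elim insertE emptyE disjE; simp add: j_def blue_step_def)
    have j: "j \<in> {0, 2, 4}"
      using cases_6[of i] by (elim disjE; simp add: j_def blue_step_def)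
    show ?thesis
    proof (rule ex1I[of _ "{(v, j), (v, j + blue_step (\<delta> v))}"])
      show "{(v, j), (v, j + blue_step (\<delta> v))} \<in> M \<and> (v, i) \<in> {(v, j), (v, j + blue_step (\<delta> v))}"
        using v j key[OF j] by (auto simp: M matching_def)
      fix e assume "e \<in> M \<and> (v, i) \<in> e"
      then obtain l where "l \<in> {0, 2, 4}" "e = {(v, l), (v, l + blue_step (\<delta> v))}"
        "i = l \<or> i = l + blue_step (\<delta> v)"
        by (auto simp: M matching_def)
      then show "e = {(v, j), (v, j + blue_step (\<delta> v))}" using key by blast
    qed
  qed
  with blue show "blue_perfect_matching G \<iota> M"
    by (auto simp: blue_perfect_matching_def perfect_matching_def hexagon_graph_def)
qed

section \<open>Rotation systems as a choice of direction at each vertex\<close>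

text \<open>Once the neighbours of \<open>v\<close> are named by index, the two cyclic permutations
  of its three edges are the two cases of \<open>turn\<close>.\<close>

lemma rotation_system_turns:
  assumes \<pi>: "rotation_system G \<pi>"
  shows "\<exists>\<delta>. turns \<delta> \<pi>"
proof -
  have "\<exists>d. \<forall>u w. (u, v) \<in> arcs G \<longrightarrow> (w, v) \<in> arcs G \<longrightarrow>
     \<pi> v {u, v} = {v, w} \<longrightarrow> \<iota> v w = turn d (\<iota> v u)" if v: "v \<in> verts G" for v
  proof -
    obtain a b c where nb: "neighbours G v = {a, b, c}" "\<iota> v a = 0" "\<iota> v b = 1" "\<iota> v c = 2"
      "a \<noteq> b" "b \<noteq> c" "a \<noteq> c"
      using neighbours_by_index[OF v] by metis
    have "incident_edges G v = {{v, a}, {v, b}, {v, c}}"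
      by (simp add: incident_edges_eq nb(1))
    then have perm: "\<pi> v permutes {{v, a}, {v, b}, {v, c}}" "cyclic_on (\<pi> v) {{v, a}, {v, b}, {v, c}}"
      using \<pi> v unfolding rotation_system_def by metis+
    have ne: "{v, a} \<noteq> {v, b}" "{v, b} \<noteq> {v, c}" "{v, a} \<noteq> {v, c}"
      using nb(5-7) by (auto simp: doubleton_eq_iff)
    from cyclic_permutation_3[OF perm ne] show ?thesis
    proof (elim disjE conjE)
      assume "\<pi> v {v, a} = {v, b}" "\<pi> v {v, b} = {v, c}" "\<pi> v {v, c} = {v, a}"
      then show ?thesis unfolding arcs_iff nb(1) insert_commute[of _ v]
        by (intro exI[of _ True]) (auto simp: turn_def nb(2-) nb(5-7)[symmetric] doubleton_eq_iff)
    next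
      assume "\<pi> v {v, a} = {v, c}" "\<pi> v {v, b} = {v, a}" "\<pi> v {v, c} = {v, b}"
      then show ?thesis unfolding arcs_iff nb(1) insert_commute[of _ v]
        by (intro exI[of _ False]) (auto simp: turn_def nb(2-) nb(5-7)[symmetric] doubleton_eq_iff)
    qed
  qed
  then obtain \<delta> where "\<And>v u w. v \<in> verts G \<Longrightarrow> (u, v) \<in> arcs G \<Longrightarrow> (w, v) \<in> arcs G \<Longrightarrow>
     \<pi> v {u, v} = {v, w} \<Longrightarrow> \<iota> v w = turn (\<delta> v) (\<iota> v u)"
    by metis
  then show ?thesis unfolding turns_def using arcsD(2) by blast
qed

lemma rotation_system_of_turns: "\<exists>\<pi>. rotation_system G \<pi> \<and> turns \<delta> \<pi>"
proof -
  have "\<exists>p. p permutes incident_edges G v \<and> cyclic_on p (incident_edges G v) \<and>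
     (\<forall>u w. (u, v) \<in> arcs G \<longrightarrow> (w, v) \<in> arcs G \<longrightarrow>
       p {u, v} = {v, w} \<longrightarrow> \<iota> v w = turn (\<delta> v) (\<iota> v u))" if v: "v \<in> verts G" for v
  proof -
    obtain a b c where nb: "neighbours G v = {a, b, c}" "\<iota> v a = 0" "\<iota> v b = 1" "\<iota> v c = 2"
      "a \<noteq> b" "b \<noteq> c" "a \<noteq> c"
      using neighbours_by_index[OF v] by metis
    have ne: "{v, a} \<noteq> {v, b}" "{v, b} \<noteq> {v, c}" "{v, a} \<noteq> {v, c}"
      using nb(5-7) by (auto simp: doubleton_eq_iff)
    have inc: "incident_edges G v = {{v, a}, {v, b}, {v, c}}"
      by (simp add: incident_edges_eq nb(1))
    \<comment> \<open>\<open>three_cycle\<close> wants the edges listed in the order of the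
      permutation, which is reversed when \<open>\<delta> v\<close> is false.\<close>
    have inc': "incident_edges G v = {{v, a}, {v, c}, {v, b}}"
      unfolding inc by (simp add: insert_commute)
    show ?thesis
    proof (cases "\<delta> v")
      case True
      let ?p = "id({v, a} := {v, b}, {v, b} := {v, c}, {v, c} := {v, a})"
      have "?p permutes incident_edges G v" "cyclic_on ?p (incident_edges G v)"
        unfolding inc using three_cycle[OF ne] by simp_all
      moreover have "\<forall>u w. (u, v) \<in> arcs G \<longrightarrow> (w, v) \<in> arcs G \<longrightarrow>
          ?p {u, v} = {v, w} \<longrightarrow> \<iota> v w = turn (\<delta> v) (\<iota> v u)"
        unfolding arcs_iff nb(1) insert_commute[of _ v]
        using True ne nb(5-7) by (auto simp: turn_def nb(2-4) doubleton_eq_iff)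
      ultimately show ?thesis by blast
    next
      case False
      let ?p = "id({v, a} := {v, c}, {v, c} := {v, b}, {v, b} := {v, a})"
      have "?p permutes incident_edges G v" "cyclic_on ?p (incident_edges G v)"
        unfolding inc' using three_cycle[OF ne(3) ne(2)[symmetric] ne(1)] by simp_all
      moreover have "\<forall>u w. (u, v) \<in> arcs G \<longrightarrow> (w, v) \<in> arcs G \<longrightarrow>
          ?p {u, v} = {v, w} \<longrightarrow> \<iota> v w = turn (\<delta> v) (\<iota> v u)"
        unfolding arcs_iff nb(1) insert_commute[of _ v]
        using False ne nb(5-7) by (auto simp: turn_def nb(2-4) doubleton_eq_iff)
      ultimately show ?thesis by blast
    qed
  qed
  then obtain \<pi> where "\<And>v. v \<in> verts G \<Longrightarrow>
     \<pi> v permutes incident_edges G v \<and> cyclic_on (\<pi> v) (incident_edges G v) \<and>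
     (\<forall>u w. (u, v) \<in> arcs G \<longrightarrow> (w, v) \<in> arcs G \<longrightarrow>
       \<pi> v {u, v} = {v, w} \<longrightarrow> \<iota> v w = turn (\<delta> v) (\<iota> v u))"
    by metis
  then show ?thesis using arcsD(2)
    by (intro exI[of _ \<pi>]) (auto simp: rotation_system_def turns_def)
qed

section \<open>Cycles of the hexagon graph and faces of the embedding\<close>

text \<open>Every \<open>X\<close>-vertex is the \<open>in_port\<close> of an arc, and by
  \<open>X_index_turn\<close> its blue partner is the \<open>out_port\<close> of the next
  arc.\<close>

lemma matching_eq:
  assumes \<pi>: "rotation_system G \<pi>" and turns: "turns \<delta> \<pi>"
  shows "matching \<delta> = (\<lambda>a. {in_port a, out_port (next_arc G \<pi> a)}) ` arcs G"
proof -
  have edge: "{in_port a, out_port (next_arc G \<pi> a)} =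
      {(v, X_index (\<iota> v u)), (v, X_index (\<iota> v u) + blue_step (\<delta> v))}"
    if a: "a \<in> arcs G" "a = (u, v)" for a u v
  proof -
    obtain w where w: "next_arc G \<pi> a = (v, w)" "\<pi> v {u, v} = {v, w}"
      using next_arc_eq_iff[OF \<pi>, of u v] a by (metis prod.collapse)
    then have vw: "(v, w) \<in> arcs G"
      using permutes_in_image[OF next_arc_permutes[OF \<pi>], of a] a(1) by simp
    have "\<iota> v w = turn (\<delta> v) (\<iota> v u)"
      using turns a arcsD(4)[OF vw] w(2) unfolding turns_def by blast
    then show ?thesis
      using X_index_turn[OF index_range, of u v] a w(1) by (simp add: in_port_def out_port_def)
  qed
  show ?thesis
  proof (intro subset_antisym subsetI)
    fix e assume "e \<in> matching \<delta>"
    then obtain v i where v: "v \<in> verts G" "i \<in> {0, 2, 4}" "e = {(v, i), (v, i + blue_step (\<delta> v))}"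
      by (auto simp: matching_def)
    obtain c where c: "c \<in> {0, 1, 2}" "i = X_index c" using v(2) X_index_image by (metis imageE)
    then obtain u where u: "u \<in> neighbours G v" "c = \<iota> v u"
      using index_bij[OF v(1)] by (metis bij_betw_def imageE)
    then have "(u, v) \<in> arcs G" by (simp add: arcs_iff)
    with edge[OF this refl] v(3) c(2) u(2)
    show "e \<in> (\<lambda>a. {in_port a, out_port (next_arc G \<pi> a)}) ` arcs G"
      by (intro image_eqI[of _ _ "(u, v)"]) simp_all
  next
    fix e assume "e \<in> (\<lambda>a. {in_port a, out_port (next_arc G \<pi> a)}) ` arcs G"
    then obtain u v where uv: "(u, v) \<in> arcs G"
      "e = {in_port (u, v), out_port (next_arc G \<pi> (u, v))}" by auto
    have "X_index (\<iota> v u) \<in> {0, 2, 4}"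
      using X_index_image index_range[OF uv(1)] by blast
    then show "e \<in> matching \<delta>"
      using arcsD(2)[OF uv(1)] unfolding uv(2) edge[OF uv(1) refl] matching_def by blast
  qed
qed

text \<open>A white edge lies on the cycle exactly when its arc lies in the orbit. An edge of
  \<open>G\<close> is induced when either of its two arcs does, so forgetting directions yields the
  induced edges.\<close>

lemma induced_subgraph_alternating_cycle:
  assumes \<pi>: "rotation_system G \<pi>" and a: "a \<in> arcs G"
  shows "induced_subgraph G \<iota> (alternating_cycle (next_arc G \<pi>) out_port in_port a) =
    subgraph_of_edges ((\<lambda>(u, v). {u, v}) ` orbit (next_arc G \<pi>) a)"
proof -
  let ?\<sigma> = "next_arc G \<pi>"
  let ?C = "alternating_cycle ?\<sigma> out_port in_port a"
  have sub: "orbit ?\<sigma> a \<subseteq> arcs G"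
    using permutes_orbit_subset[OF next_arc_permutes[OF \<pi>] a] .
  have mem: "white_edge b \<in> ?C \<longleftrightarrow> b \<in> orbit ?\<sigma> a" if b: "b \<in> arcs G" for b
  proof
    assume "white_edge b \<in> ?C"
    then obtain c where c: "c \<in> orbit ?\<sigma> a"
      "white_edge b = {out_port c, in_port c} \<or> white_edge b = {in_port c, out_port (?\<sigma> c)}"
      unfolding alternating_cycle_def by auto
    have "c \<in> arcs G" using c(1) sub by blast
    \<comment> \<open>The two ports on the right lie in one hexagon, whereas a white edge joins two
      different ones.\<close>
    have "white_edge b \<noteq> {in_port c, out_port (?\<sigma> c)}"
      using fst_next_arc[OF \<open>c \<in> arcs G\<close>] arcsD(3)[of "fst b" "snd b"] b
      by (auto simp: white_edge_def in_port_def out_port_def doubleton_eq_iff)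
    with c(2) have "out_port b = out_port c"
      using ports_disjoint b \<open>c \<in> arcs G\<close> by (auto simp: white_edge_def doubleton_eq_iff)
    then show "b \<in> orbit ?\<sigma> a"
      using inj_out_port b \<open>c \<in> arcs G\<close> c(1) by (auto dest: inj_onD)
  qed (auto simp: alternating_cycle_def white_edge_def)
  have "edge1 G \<iota> u v \<in> ?C \<or> edge2 G \<iota> u v \<in> ?C \<longleftrightarrow>
      (u, v) \<in> orbit ?\<sigma> a \<or> (v, u) \<in> orbit ?\<sigma> a" if uv: "(u, v) \<in> arcs G" for u v
  proof -
    have "edge1 G \<iota> u v \<in> ?C \<or> edge2 G \<iota> u v \<in> ?C \<longleftrightarrow>
        white_edge (u, v) \<in> ?C \<or> white_edge (v, u) \<in> ?C"
      using edge12_eq[OF uv] by (metis doubleton_eq_iff)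
    then show ?thesis using mem uv arcsD(4)[OF uv] by blast
  qed
  then have "{{u, v} | u v. {u, v} \<in> edges G \<and> (edge1 G \<iota> u v \<in> ?C \<or> edge2 G \<iota> u v \<in> ?C)} =
      {{u, v} | u v. (u, v) \<in> arcs G \<and> ((u, v) \<in> orbit ?\<sigma> a \<or> (v, u) \<in> orbit ?\<sigma> a)}"
    unfolding arcs_def by blast
  also have "\<dots> = (\<lambda>(u, v). {u, v}) ` orbit ?\<sigma> a"
    using sub arcsD(4) by (fastforce simp: insert_commute)
  finally show ?thesis by (simp add: induced_subgraph_def)
qed

lemma face_boundaries_eq_cycle_subgraphs:
  assumes \<pi>: "rotation_system G \<pi>" and turns: "turns \<delta> \<pi>"
  shows "face_boundaries G \<pi> = cycle_subgraphs G \<iota> (matching \<delta>)"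
proof -
  let ?\<sigma> = "next_arc G \<pi>"
  \<comment> \<open>Joining different hexagons, a white edge is never in the matching, so the
    symmetric difference is a union.\<close>
  have "white_edge b \<notin> matching \<delta>" if "b \<in> arcs G" for b
    using arcsD(3)[of "fst b" "snd b"] that
    by (auto simp: matching_def white_edge_def in_port_def out_port_def doubleton_eq_iff)
  then have "sym_diff (matching \<delta>) (white_edges G \<iota>) = white_edge ` arcs G \<union> matching \<delta>"
    unfolding white_edges_eq by blast
  then have "{C. is_cycle C \<and> C \<subseteq> sym_diff (matching \<delta>) (white_edges G \<iota>)} =
      alternating_cycle ?\<sigma> out_port in_port ` arcs G"
    unfolding matching_eq[OF assms] white_edge_def
    using cycles_of_alternating_graph[OF next_arc_permutes[OF \<pi>] finite_arcs next_arc_neq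
        inj_out_port inj_in_port ports_disjoint] by simp
  then have "cycle_subgraphs G \<iota> (matching \<delta>) =
      (\<lambda>a. induced_subgraph G \<iota> (alternating_cycle ?\<sigma> out_port in_port a)) ` arcs G"
    by (simp add: cycle_subgraphs_def image_image)
  also have "\<dots> = face_boundaries G \<pi>"
    unfolding face_boundaries_eq[OF \<pi>]
    by (rule image_cong) (simp_all add: induced_subgraph_alternating_cycle[OF \<pi>])
  finally show ?thesis ..
qed

end

theorem theorem2:
  fixes G :: "'v ugraph" and \<iota> :: "'v \<Rightarrow> 'v \<Rightarrow> 6"
  assumes "finite_graph G" and "simple_graph G" and "cubic_graph G"
    and "index_assignment G \<iota>"
  shows "(\<forall>M. blue_perfect_matching G \<iota> M \<longrightarrow>
            (\<exists>\<pi>. rotation_system G \<pi> \<and> face_boundaries G \<pi> = cycle_subgraphs G \<iota> M)) \<and>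
         (\<forall>\<pi>. rotation_system G \<pi> \<longrightarrow>
            (\<exists>M. blue_perfect_matching G \<iota> M \<and> cycle_subgraphs G \<iota> M = face_boundaries G \<pi>))"
proof -
  interpret hexagon G \<iota>
    using assms by unfold_locales
  \<comment> \<open>Both directions pass through \<open>\<delta>\<close>: a blue perfect matching
    yields \<open>\<delta>\<close>, from which a rotation system is built; conversely a rotation
    system yields \<open>\<delta>\<close>, and \<open>matching \<delta>\<close> is the matching
    sought.\<close>
  show ?thesis
    using blue_perfect_matching_iff rotation_system_turns rotation_system_of_turns
      face_boundaries_eq_cycle_subgraphs by metis
qed

end
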